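(* Let $T$ be a $\{1,3\}$-tree. Then the set of vertices of the polytope $\mathcal{Q}_T$ is exactly $\{\mathbbm{1}'_H : H \text{ is a collection of pairwise vertex-disjoint leaf-paths in } T\}$.
   Context: A $\{1,3\}$-tree is a finite tree all of whose nodes have degree $1$ (leaves) or $3$ (internal nodes); $E$ is its edge set and $I$ its set of internal nodes. A leaf-edge is an edge incident with a leaf; a leaf-path is a path in $T$ whose two extreme edges are leaf-edges (a single edge joining two leaves is a leaf-path); the empty collection is allowed. For such a collection $H$, $\mathbbm{1}'_H=(\mathbbm{1}_H,z)\in\mathbb{Z}^E\times\mathbb{Z}^I$, where $\mathbbm{1}_H$ is the characteristic vector of the edge set of $H$ and $z_v=1$ if $v$ is an internal node of some leaf-path in $H$, $z_v=0$ otherwise. $\mathcal{Q}_T\subset\mathbb{R}^E\times\mathbb{R}^I$ is the set of $(w,z)$ such that for every internal node $v$ with incident edges $a,b,c$: $w_a\le w_b+w_c$, $w_b\le w_a+w_c$, $w_c\le w_a+w_b$, $w_a+w_b+w_c=2z_v$, $z_v\le1$; and if $T$ is a single edge $e$, $\mathcal{Q}_T=\{w:0\le w_e\le1\}$. *)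

theory Defs
  imports "HOL-Analysis.Analysis"
begin

text \<open>Edges are two-element sets of nodes; paths and cycles are represented by their lists of
  nodes, a cycle being listed without repeating its first node.\<close>

definition simple_graph :: "'v set \<Rightarrow> 'v set set \<Rightarrow> bool" where
  "simple_graph V E \<longleftrightarrow> finite V \<and> (\<forall>e\<in>E. e \<subseteq> V \<and> card e = 2)"

definition path_in :: "'v set \<Rightarrow> 'v set set \<Rightarrow> 'v list \<Rightarrow> bool" where
  "path_in V E p \<longleftrightarrow>
     p \<noteq> [] \<and> set p \<subseteq> V \<and> distinct p \<and> successively (\<lambda>x y. {x, y} \<in> E) p"

definition cycle_in :: "'v set \<Rightarrow> 'v set set \<Rightarrow> 'v list \<Rightarrow> bool" where
  "cycle_in V E p \<longleftrightarrow> path_in V E p \<and> length p \<ge> 3 \<and> {last p, hd p} \<in> E"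

definition connected_graph :: "'v set \<Rightarrow> 'v set set \<Rightarrow> bool" where
  "connected_graph V E \<longleftrightarrow>
     V \<noteq> {} \<and> (\<forall>u\<in>V. \<forall>v\<in>V. \<exists>p. path_in V E p \<and> hd p = u \<and> last p = v)"

definition tree :: "'v set \<Rightarrow> 'v set set \<Rightarrow> bool" where
  "tree V E \<longleftrightarrow> simple_graph V E \<and> connected_graph V E \<and> (\<nexists>p. cycle_in V E p)"

definition incident_edges :: "'v set set \<Rightarrow> 'v \<Rightarrow> 'v set set" where
  "incident_edges E v = {e \<in> E. v \<in> e}"

definition node_degree :: "'v set set \<Rightarrow> 'v \<Rightarrow> nat" where
  "node_degree E v = card (incident_edges E v)"

definition tree_1_3 :: "'v set \<Rightarrow> 'v set set \<Rightarrow> bool" where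
  "tree_1_3 V E \<longleftrightarrow> tree V E \<and> (\<forall>v\<in>V. node_degree E v = 1 \<or> node_degree E v = 3)"

definition leaves :: "'v set \<Rightarrow> 'v set set \<Rightarrow> 'v set" where
  "leaves V E = {v \<in> V. node_degree E v = 1}"

definition internal_nodes :: "'v set \<Rightarrow> 'v set set \<Rightarrow> 'v set" where
  "internal_nodes V E = {v \<in> V. node_degree E v = 3}"

definition leaf_edge :: "'v set \<Rightarrow> 'v set set \<Rightarrow> 'v set \<Rightarrow> bool" where
  "leaf_edge V E e \<longleftrightarrow> e \<in> E \<and> (\<exists>v\<in>leaves V E. v \<in> e)"

fun path_edges :: "'v list \<Rightarrow> 'v set list" where
  "path_edges (x # y # p) = {x, y} # path_edges (y # p)"
| "path_edges _ = []"

definition path_interior :: "'v list \<Rightarrow> 'v set" where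
  "path_interior p = set (butlast (tl p))"

text \<open>For a path with at least two edges the first and the last edge are required to be
  leaf-edges (its ends are then leaves, as inner nodes of a path have degree at least two).
  A path with a single edge is a leaf-path only if both its ends are leaves; an edge joining
  a leaf to an internal node is not a leaf-path.\<close>

definition leaf_path :: "'v set \<Rightarrow> 'v set set \<Rightarrow> 'v list \<Rightarrow> bool" where
  "leaf_path V E p \<longleftrightarrow>
     path_in V E p \<and> path_edges p \<noteq> [] \<and>
     leaf_edge V E (hd (path_edges p)) \<and> leaf_edge V E (last (path_edges p)) \<and>
     (length (path_edges p) = 1 \<longrightarrow> set p \<subseteq> leaves V E)"

text \<open>A path and its reversal are different lists, but they share nodes, so a collection of
  pairwise disjoint paths contains at most one of them.\<close>

definition disjoint_leaf_paths :: "'v set \<Rightarrow> 'v set set \<Rightarrow> 'v list set \<Rightarrow> bool" where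
  "disjoint_leaf_paths V E H \<longleftrightarrow>
     (\<forall>p\<in>H. leaf_path V E p) \<and> pairwise (\<lambda>p q. disjnt (set p) (set q)) H"

text \<open>The space of real vectors indexed by \<^term>\<open>E\<close> and by the internal nodes is the coordinate
  subspace of \<^typ>\<open>(real ^ 'v set) \<times> (real ^ 'v)\<close> in which all other coordinates vanish. (The set
  of internal nodes may be empty, so it cannot itself serve as an index type.)\<close>

definition coord_space :: "'v::finite set \<Rightarrow> 'v set set \<Rightarrow> ((real ^ 'v set) \<times> (real ^ 'v)) set" where
  "coord_space V E =
     {(w, z). (\<forall>e. e \<notin> E \<longrightarrow> w $ e = 0) \<and> (\<forall>v. v \<notin> internal_nodes V E \<longrightarrow> z $ v = 0)}"

definition char_vec ::
  "'v::finite set \<Rightarrow> 'v set set \<Rightarrow> 'v list set \<Rightarrow> (real ^ 'v set) \<times> (real ^ 'v)" where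
  "char_vec V E H =
     (\<chi> e. if e \<in> E \<and> (\<exists>p\<in>H. e \<in> set (path_edges p)) then 1 else 0,
      \<chi> v. if v \<in> internal_nodes V E \<and> (\<exists>p\<in>H. v \<in> path_interior p) then 1 else 0)"

definition Q_poly :: "'v::finite set \<Rightarrow> 'v set set \<Rightarrow> ((real ^ 'v set) \<times> (real ^ 'v)) set" where
  "Q_poly V E =
     (if \<exists>e. E = {e}
      then {(w, z) \<in> coord_space V E. \<forall>e\<in>E. 0 \<le> w $ e \<and> w $ e \<le> 1}
      else {(w, z) \<in> coord_space V E.
              \<forall>v\<in>internal_nodes V E. \<forall>a b c.
                distinct [a, b, c] \<and> incident_edges E v = {a, b, c} \<longrightarrow>
                  w $ a \<le> w $ b + w $ c \<and> w $ b \<le> w $ a + w $ c \<and> w $ c \<le> w $ a + w $ b \<and>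
                  w $ a + w $ b + w $ c = 2 * z $ v \<and> z $ v \<le> 1})"


lemma polyhedron_linear_le:
  fixes f :: "'a::euclidean_space \<Rightarrow> real"
  assumes "linear f"
  shows "polyhedron {x. f x \<le> b}"
proof -
  have "f x = adjoint f 1 \<bullet> x" for x
    using adjoint_works[OF assms, of x 1] by (simp add: inner_commute)
  then show ?thesis
    using polyhedron_halfspace_le[of "adjoint f 1" b] by simp
qed

lemma polyhedron_all:
  fixes P :: "'i::finite \<Rightarrow> 'a::euclidean_space \<Rightarrow> bool"
  assumes "\<And>i. polyhedron {x. P i x}"
  shows "polyhedron {x. \<forall>i. P i x}"
proof -
  have "{x. \<forall>i. P i x} = (\<Inter>i. {x. P i x})" by auto
  then show ?thesis using assms by auto
qed

lemma polyhedron_imp: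
  fixes Q :: "'a::euclidean_space \<Rightarrow> bool"
  assumes "P \<Longrightarrow> polyhedron {x. Q x}"
  shows "polyhedron {x. P \<longrightarrow> Q x}"
  using assms by (cases P) auto

lemma polyhedron_conj:
  fixes P Q :: "'a::euclidean_space \<Rightarrow> bool"
  assumes "polyhedron {x. P x}" "polyhedron {x. Q x}"
  shows "polyhedron {x. P x \<and> Q x}"
  using polyhedron_Int[OF assms] by (simp add: Collect_conj_eq)

lemma polyhedron_le:
  fixes f g :: "'a::euclidean_space \<Rightarrow> real"
  assumes "linear f" "linear g"
  shows "polyhedron {x. f x \<le> g x}"
  using polyhedron_linear_le[OF linear_compose_sub[OF assms], of 0] by simp

lemma polyhedron_eq:
  fixes f g :: "'a::euclidean_space \<Rightarrow> real"
  assumes "linear f" "linear g"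
  shows "polyhedron {x. f x = g x}"
  using polyhedron_conj[OF polyhedron_le[OF assms] polyhedron_le[OF assms(2,1)]]
  by (simp add: eq_iff)

lemma linear_coords:
  "linear (\<lambda>x::(real ^ 'm::finite) \<times> (real ^ 'n::finite). fst x $ i)"
  "linear (\<lambda>x::(real ^ 'm::finite) \<times> (real ^ 'n::finite). snd x $ j)"
  by (auto intro!: linearI)

lemma linear_zero_real: "linear (\<lambda>x. 0 :: real)"
  by (auto intro!: linearI)

lemma polyhedron_Q_poly: "polyhedron (Q_poly V E)"
proof -
  note lin = linear_coords linear_zero_real linear_compose_add linear_compose_scale_right
  note poly = polyhedron_all polyhedron_imp polyhedron_conj polyhedron_le polyhedron_eq
  have 1: "polyhedron (coord_space V E)"
  proof -
    have "coord_space V E = {x. (\<forall>e. e \<notin> E \<longrightarrow> fst x $ e = 0) \<and>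
        (\<forall>v. v \<notin> internal_nodes V E \<longrightarrow> snd x $ v = 0)}"
      by (auto simp: coord_space_def)
    then show ?thesis by (auto intro!: poly lin)
  qed
  show ?thesis
  proof (cases "\<exists>e. E = {e}")
    case True
    have "Q_poly V E = coord_space V E \<inter> {x. \<forall>e. e \<in> E \<longrightarrow> 0 \<le> fst x $ e \<and> fst x $ e \<le> 1}"
    proof -
      have "(w, z) \<in> Q_poly V E \<longleftrightarrow> (w, z) \<in> coord_space V E \<and>
          (\<forall>e. e \<in> E \<longrightarrow> 0 \<le> w $ e \<and> w $ e \<le> 1)" for w z
        unfolding Q_poly_def if_P[OF True] mem_Collect_eq prod.case by blast
      then show ?thesis by auto
    qed
    moreover have "polyhedron {x::(real ^ 'a set) \<times> (real ^ 'a).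
        \<forall>e. e \<in> E \<longrightarrow> 0 \<le> fst x $ e \<and> fst x $ e \<le> 1}"
      by (intro polyhedron_all polyhedron_imp polyhedron_conj
          polyhedron_linear_le[OF linear_coords(1)] polyhedron_le lin)
    ultimately show ?thesis using 1 by simp
  next
    case False
    define C where "C v a b c \<longleftrightarrow> v \<in> internal_nodes V E \<and> distinct [a, b, c] \<and>
      incident_edges E v = {a, b, c}" for v a b c
    define P where "P v a b c x \<longleftrightarrow> fst x $ a \<le> fst x $ b + fst x $ c \<and>
      fst x $ b \<le> fst x $ a + fst x $ c \<and> fst x $ c \<le> fst x $ a + fst x $ b \<and>
      fst x $ a + fst x $ b + fst x $ c = 2 *\<^sub>R snd x $ v \<and> snd x $ v \<le> 1"
      for v a b c and x :: "(real ^ 'a set) \<times> (real ^ 'a)"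
    have "polyhedron {x. P v a b c x}" for v a b c
      unfolding P_def by (intro polyhedron_conj polyhedron_linear_le[OF linear_coords(2)]
          polyhedron_le polyhedron_eq lin)
    then have "polyhedron {x. \<forall>v a b c. C v a b c \<longrightarrow> P v a b c x}"
      by (intro polyhedron_all polyhedron_imp)
    moreover have "Q_poly V E = coord_space V E \<inter> {x. \<forall>v a b c. C v a b c \<longrightarrow> P v a b c x}"
    proof -
      have "(w, z) \<in> Q_poly V E \<longleftrightarrow>
          (w, z) \<in> coord_space V E \<and> (\<forall>v a b c. C v a b c \<longrightarrow> P v a b c (w, z))" for w z
        unfolding Q_poly_def if_not_P[OF False] C_def P_def mem_Collect_eq prod.case fst_conv
          snd_conv real_scaleR_def by blast
      then show ?thesis by auto
    qed
    ultimately show ?thesis using 1 by simp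
  qed
qed

lemma leaves_adjacent_imp_single_edge:
  assumes T: "tree V E" and e: "{u, v} \<in> E"
    and u: "incident_edges E u = {{u, v}}" and v: "incident_edges E v = {{u, v}}"
  shows "E = {{u, v}}"
proof -
  have sg: "simple_graph V E" and con: "connected_graph V E"
    using T by (auto simp: tree_def)
  have uV: "u \<in> V" using sg e by (auto simp: simple_graph_def)
  have nu: "y \<in> {u, v}" if "{u, y} \<in> E" for y
  proof -
    have "{u, y} \<in> incident_edges E u" using that by (simp add: incident_edges_def)
    then have "{u, y} = {u, v}" unfolding u by simp
    then show ?thesis by blast
  qed
  have nv: "y \<in> {u, v}" if "{v, y} \<in> E" for y
  proof -
    have "{v, y} \<in> incident_edges E v" using that by (simp add: incident_edges_def)
    then have "{v, y} = {u, v}" unfolding v by simp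
    then show ?thesis by blast
  qed
  have "x \<in> {u, v}" if "x \<in> V" for x
  proof -
    obtain p where p: "path_in V E p" "hd p = u" "last p = x"
      using con uV \<open>x \<in> V\<close> unfolding connected_graph_def by blast
    then obtain q where q: "p = u # q" by (cases p) (auto simp: path_in_def)
    show ?thesis
    proof (cases q)
      case Nil then show ?thesis using p q by simp
    next
      case (Cons y r)
      then have y: "y = v" using p q nu[of y] by (auto simp: path_in_def)
      have "r = []"
      proof (cases r)
        case (Cons t s)
        then have "{v, t} \<in> E" "t \<noteq> u" "t \<noteq> v"
          using p q \<open>q = y # r\<close> y by (auto simp: path_in_def)
        then show ?thesis using nv by blast
      qed simp
      then show ?thesis using p q Cons y by simp
    qed
  qed
  then have sub: "V \<subseteq> {u, v}" by blast
  have "f = {u, v}" if "f \<in> E" for f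
  proof -
    have "f \<subseteq> {u, v}" "card f = 2" using sg that sub by (auto simp: simple_graph_def)
    moreover have "card {u, v} \<le> 2" by (simp add: card_insert_if)
    ultimately show ?thesis by (metis card_seteq finite.emptyI finite.insertI)
  qed
  then show ?thesis using e by blast
qed

lemma edge_has_internal_node:
  assumes T: "tree_1_3 V E" and ns: "\<nexists>e. E = {e}" and e: "e \<in> E"
  shows "\<exists>v\<in>internal_nodes V E. e \<in> incident_edges E v"
proof (rule ccontr)
  assume *: "\<not> ?thesis"
  have "e \<subseteq> V" "card e = 2" using T e by (auto simp: tree_1_3_def tree_def simple_graph_def)
  then obtain u v where uv: "e = {u, v}" "u \<in> V" "v \<in> V" by (auto simp: card_2_iff)
  have "incident_edges E x = {e}" if "x \<in> {u, v}" for x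
  proof -
    have m: "e \<in> incident_edges E x" using that uv e by (auto simp: incident_edges_def)
    have "node_degree E x = 1" using * T m that uv by (auto simp: tree_1_3_def internal_nodes_def)
    then show ?thesis using m by (auto simp: node_degree_def card_1_singleton_iff)
  qed
  then have "E = {{u, v}}"
    using leaves_adjacent_imp_single_edge[of V E u v] T uv e by (auto simp: tree_1_3_def)
  then show False using ns by blast
qed

lemma internal_node_edges:
  assumes "v \<in> internal_nodes V E" "a \<in> incident_edges E v"
  obtains b c where "distinct [a, b, c]" "incident_edges E v = {a, b, c}"
proof -
  have "card (incident_edges E v) = 3" using assms by (simp add: internal_nodes_def node_degree_def)
  then have "card (incident_edges E v - {a}) = 2"
    using assms by (simp add: card_Diff_singleton)
  then obtain b c where "incident_edges E v - {a} = {b, c}" "b \<noteq> c" by (auto simp: card_2_iff)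
  then have "distinct [a, b, c]" "incident_edges E v = {a, b, c}" using assms by auto
  then show ?thesis using that by blast
qed

lemma Q_poly_bounds:
  assumes T: "tree_1_3 V E" and x: "(w, z) \<in> Q_poly V E"
  shows "0 \<le> w $ e \<and> w $ e \<le> 1" and "0 \<le> z $ v \<and> z $ v \<le> 1"
proof -
  have cs: "(w, z) \<in> coord_space V E" using x by (auto simp: Q_poly_def split: if_splits)
  have loc: "0 \<le> w $ a \<and> w $ a \<le> 1 \<and> 0 \<le> z $ u \<and> z $ u \<le> 1"
    if ns: "\<nexists>e. E = {e}" and u: "u \<in> internal_nodes V E" and a: "a \<in> incident_edges E u" for a u
  proof -
    obtain b c where bc: "distinct [a, b, c]" "incident_edges E u = {a, b, c}"
      using internal_node_edges[OF u a] .
    have "\<forall>v\<in>internal_nodes V E. \<forall>a b c.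
        distinct [a, b, c] \<and> incident_edges E v = {a, b, c} \<longrightarrow>
          w $ a \<le> w $ b + w $ c \<and> w $ b \<le> w $ a + w $ c \<and> w $ c \<le> w $ a + w $ b \<and>
          w $ a + w $ b + w $ c = 2 * z $ v \<and> z $ v \<le> 1"
      using x ns unfolding Q_poly_def by (simp only: if_False) blast
    then have "w $ a \<le> w $ b + w $ c \<and> w $ b \<le> w $ a + w $ c \<and> w $ c \<le> w $ a + w $ b \<and>
          w $ a + w $ b + w $ c = 2 * z $ u \<and> z $ u \<le> 1"
      using u bc by blast
    then show ?thesis by linarith
  qed
  show "0 \<le> w $ e \<and> w $ e \<le> 1"
  proof (cases "e \<in> E")
    case False then show ?thesis using cs by (auto simp: coord_space_def)
  next
    case True
    show ?thesis
    proof (cases "\<exists>e. E = {e}")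
      case True
      then show ?thesis using x \<open>e \<in> E\<close> by (auto simp: Q_poly_def)
    next
      case False
      then show ?thesis using loc edge_has_internal_node[OF T _ \<open>e \<in> E\<close>] by blast
    qed
  qed
  show "0 \<le> z $ v \<and> z $ v \<le> 1"
  proof (cases "v \<in> internal_nodes V E")
    case False then show ?thesis using cs by (auto simp: coord_space_def)
  next
    case True
    then have 3: "card (incident_edges E v) = 3" by (simp add: internal_nodes_def node_degree_def)
    then have "\<nexists>e. E = {e}"
      by (metis (no_types, lifting) card.empty card_1_singleton_iff card_mono finite.emptyI
          finite.insertI incident_edges_def mem_Collect_eq numeral_le_one_iff One_nat_def
          semiring_norm(70) subsetI)
    moreover obtain a where "a \<in> incident_edges E v" using 3 by fastforce
    ultimately show ?thesis using loc True by blast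
  qed
qed

lemma polytope_Q_poly:
  assumes "tree_1_3 V E"
  shows "polytope (Q_poly V E)"
proof -
  have "Q_poly V E \<subseteq> cbox 0 1 \<times> cbox 0 1"
    using Q_poly_bounds[OF assms] by (auto simp: mem_box_cart)
  then have "bounded (Q_poly V E)"
    by (rule bounded_subset[OF bounded_Times[OF bounded_cbox bounded_cbox]])
  then show ?thesis
    using polyhedron_Q_poly by (simp add: polytope_eq_bounded_polyhedron)
qed

end

theory Submission
  imports Defs
begin

text \<open>At an internal node the constraints say that the three weights lie in the tetrahedron with
  vertices 000, 110, 101, 011, so a 0/1 point of the polytope is an edge set meeting each internal
  node in zero or two edges; in a tree, such a set is a disjoint union of leaf-paths. Points of the
  polytope have coordinates in the unit interval and \<open>z\<close> is determined by \<open>w\<close>, so 0/1 points are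
  extreme. Conversely, let some edge be fractional. If one weight at a node is fractional, any change
  of it extends to the two other weights at that node without violating the constraints that are
  tight there. Starting from a fractional edge and extending node by node through the tree yields a
  direction along which the point can be moved both ways, so it is not extreme.\<close>

section \<open>Paths and trees\<close>

text \<open>A path from inside a node set to outside must leave it somewhere. This supplies the edge
  along which a connected part of the tree can be enlarged.\<close>

lemma successively_crossing:
  assumes "successively R p" "p \<noteq> []" "hd p \<in> S" "last p \<notin> S"
  shows "\<exists>u\<in>S \<inter> set p. \<exists>v\<in>set p - S. R u v"
  using assms
proof (induction p)
  case (Cons x p)
  show ?case
  proof (cases "p \<noteq> [] \<and> hd p \<in> S")
    case True
    then have "\<exists>u\<in>S \<inter> set p. \<exists>v\<in>set p - S. R u v"
      using Cons.IH Cons.prems by (auto simp: successively_Cons)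
    then show ?thesis by auto
  next
    case False
    then have "p \<noteq> []" "hd p \<notin> S" using Cons.prems by auto
    then show ?thesis using Cons.prems by (auto simp: successively_Cons)
  qed
qed simp

text \<open>Membership in \<open>S\<close> is constant along the chain. Applied with
  \<open>S\<close> the node set of another path, it shows that paths sharing a node have comparable
  node sets.\<close>

lemma successively_closed_subset:
  assumes "successively R p" "\<And>x y. R x y \<Longrightarrow> x \<in> S \<longleftrightarrow> y \<in> S" "x \<in> set p" "x \<in> S"
  shows "set p \<subseteq> S"
proof -
  have "\<forall>y\<in>set p. y \<in> S \<longleftrightarrow> hd p \<in> S"
    using assms(1,2)
  proof (induction p)
    case (Cons z p)
    then show ?case by (cases p) auto
  qed simp
  then show ?thesis using assms(3,4) by blast
qed

lemma path_in_rev: "path_in V E (rev p) \<longleftrightarrow> path_in V E p"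
  by (simp add: path_in_def insert_commute)

lemma path_in_snoc:
  assumes "path_in S E p" "{last p, v} \<in> E" "v \<notin> S"
  shows "path_in (insert v S) E (p @ [v])"
  using assms by (auto simp: path_in_def successively_append_iff)

lemma path_in_mono: "path_in S E p \<Longrightarrow> S \<subseteq> S' \<Longrightarrow> path_in S' E p"
  by (auto simp: path_in_def)

text \<open>Since \<open>path_in\<close> confines the nodes to its first argument,
  \<open>connected_graph S E\<close> with the full edge set \<open>E\<close> speaks of the subgraph
  induced on \<open>S\<close>.\<close>

lemma connected_graph_insert:
  assumes con: "connected_graph S E" and u: "u \<in> S" "{u, v} \<in> E" and v: "v \<notin> S"
  shows "connected_graph (insert v S) E"
proof -
  have to_v: "\<exists>p. path_in (insert v S) E p \<and> hd p = x \<and> last p = v" if x: "x \<in> S" for x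
  proof -
    obtain p where p: "path_in S E p" "hd p = x" "last p = u"
      using con x u unfolding connected_graph_def by blast
    have "path_in (insert v S) E (p @ [v])" using path_in_snoc[of S E p v] p u v by simp
    moreover have "hd (p @ [v]) = x" using p by (auto simp: path_in_def)
    ultimately show ?thesis by (metis last_snoc)
  qed
  have from_v: "\<exists>p. path_in (insert v S) E p \<and> hd p = v \<and> last p = x" if x: "x \<in> S" for x
    using to_v[OF x] path_in_rev by (metis hd_rev last_rev)
  have "path_in (insert v S) E [v]" by (simp add: path_in_def)
  then have vv: "\<exists>p. path_in (insert v S) E p \<and> hd p = v \<and> last p = v" by force
  have old: "\<exists>p. path_in (insert v S) E p \<and> hd p = x \<and> last p = y" if "x \<in> S" "y \<in> S" for x y
    using con that path_in_mono[of S E _ "insert v S"] unfolding connected_graph_def by blast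
  show ?thesis
    unfolding connected_graph_def using to_v from_v vv old by blast
qed

text \<open>Two different neighbours of \<open>v\<close> in \<open>S\<close> would be joined by a
  path inside \<open>S\<close>, which \<open>v\<close> closes to a cycle.\<close>

lemma tree_unique_attachment:
  assumes T: "tree V E" and S: "S \<subseteq> V" "connected_graph S E"
    and v: "v \<in> V" "v \<notin> S" and x: "x \<in> S" "{x, v} \<in> E" and y: "y \<in> S" "{y, v} \<in> E"
  shows "x = y"
proof (rule ccontr)
  assume "x \<noteq> y"
  obtain p where p: "path_in S E p" "hd p = x" "last p = y"
    using S x y unfolding connected_graph_def by blast
  then have ne: "p \<noteq> []" by (auto simp: path_in_def)
  \<comment> \<open>Together with \<open>v\<close> this gives the three nodes that a cycle must
    have.\<close>
  have len: "length p \<ge> 2"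
    using ne p \<open>x \<noteq> y\<close> by (cases p; cases "tl p") auto
  have "path_in V E (p @ [v])"
    using path_in_mono[OF path_in_snoc[of S E p v]] p y v S by auto
  then have "cycle_in V E (p @ [v])"
    using len ne p x by (auto simp: cycle_in_def insert_commute)
  then show False using T by (auto simp: tree_def)
qed

text \<open>The tree is built up node by node from \<open>r\<close>, each new node having exactly
  one neighbour among the earlier ones. That uniqueness is what lets local choices be extended
  without conflict.\<close>

lemma tree_grow_induct [consumes 2, case_names root grow]:
  assumes T: "tree V E" and r: "r \<in> V"
    and root: "P {r}"
    and grow: "\<And>S u v. \<lbrakk>S \<subseteq> V; u \<in> S; v \<in> V; v \<notin> S; {u, v} \<in> E;
        \<And>x. x \<in> S \<Longrightarrow> {x, v} \<in> E \<Longrightarrow> x = u; P S\<rbrakk> \<Longrightarrow> P (insert v S)"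
  shows "P V"
proof -
  have finV: "finite V" and con: "connected_graph V E"
    using T by (auto simp: tree_def simple_graph_def)
  \<comment> \<open>Connectedness of \<open>S\<close> is carried through the induction on the number
    of missing nodes, because the unique attachment depends on it.\<close>
  have reach: "P V" if "S \<subseteq> V" "connected_graph S E" "P S" for S
    using that
  proof (induction "card (V - S)" arbitrary: S rule: less_induct)
    case less
    show ?case
    proof (cases "S = V")
      case False
      then obtain x where x: "x \<in> V" "x \<notin> S" using less.prems by blast
      obtain s where s: "s \<in> S" using less.prems by (auto simp: connected_graph_def)
      obtain p where p: "path_in V E p" "hd p = s" "last p = x"
        using con x s less.prems unfolding connected_graph_def by blast
      obtain u v where uv: "u \<in> S" "v \<notin> S" "v \<in> set p" "{u, v} \<in> E"
        using successively_crossing[of "\<lambda>x y. {x, y} \<in> E" p S] p s x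
        by (auto simp: path_in_def)
      then have vV: "v \<in> V" using p by (auto simp: path_in_def)
      have "P (insert v S)"
        using grow[of S u v] tree_unique_attachment[OF T, of S v] less.prems uv vV by blast
      moreover have "card (V - insert v S) < card (V - S)"
        using finV vV uv by (intro psubset_card_mono) auto
      ultimately show ?thesis
        using less.hyps[of "insert v S"] less.prems(1) vV
          connected_graph_insert[OF less.prems(2) uv(1,4,2)] by simp
    qed (use less in simp)
  qed
  have "connected_graph {r} E"
    by (simp add: connected_graph_def path_in_def exI[of _ "[r]"])
  then show ?thesis using reach[of "{r}"] root r by simp
qed

section \<open>Edges and interior nodes of a path\<close>

lemma path_edges_append: "path_edges (xs @ y # ys) = path_edges (xs @ [y]) @ path_edges (y # ys)"
proof (induction xs)
  case (Cons x xs)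
  then show ?case by (cases xs) auto
qed simp

lemma path_edges_rev: "path_edges (rev p) = rev (path_edges p)"
proof (induction p rule: path_edges.induct)
  case (1 x y p)
  have "path_edges (rev (x # y # p)) = path_edges (rev (y # p)) @ [{y, x}]"
    using path_edges_append[of "rev p" y "[x]"] by simp
  then show ?case using 1 by (simp add: insert_commute)
qed auto

lemma path_edges_subset: "e \<in> set (path_edges p) \<Longrightarrow> e \<subseteq> set p"
  by (induction p rule: path_edges.induct) auto

lemma path_edges_in_graph:
  "successively (\<lambda>x y. {x, y} \<in> F) p \<longleftrightarrow> set (path_edges p) \<subseteq> F"
  by (induction p rule: path_edges.induct) auto

lemma path_interiorE:
  assumes "v \<in> path_interior p"
  obtains p1 x y p2 where "p = p1 @ x # v # y # p2"
proof -
  obtain q1 q2 where q: "butlast (tl p) = q1 @ v # q2"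
    using assms by (auto simp: path_interior_def in_set_conv_decomp)
  then have "tl p \<noteq> []" by auto
  then obtain x t where p: "p = x # t" "t \<noteq> []" by (cases p) auto
  then have "p = x # q1 @ v # q2 @ [last t]"
    using q append_butlast_last_id[of t] by simp
  moreover obtain p1 x' where "x # q1 = p1 @ [x']" by (metis list.distinct(1) rev_exhaust)
  moreover obtain y p2 where "q2 @ [last t] = y # p2" by (cases q2) auto
  ultimately have "p = p1 @ x' # v # y # p2" by (metis append.assoc append_Cons append_Nil)
  then show ?thesis by (rule that)
qed

text \<open>Splitting the edge list at \<open>v\<close> leaves two outer segments whose nodes, by
  distinctness, do not include \<open>v\<close>.\<close>

lemma path_edges_at_interior:
  assumes "distinct (p1 @ x # v # y # p2)"
  shows "{e \<in> set (path_edges (p1 @ x # v # y # p2)). v \<in> e} = {{x, v}, {v, y}}"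
proof -
  have "path_edges (p1 @ x # v # y # p2) =
      path_edges (p1 @ [x]) @ {x, v} # {v, y} # path_edges (y # p2)"
    using path_edges_append[of p1 x "v # y # p2"] by simp
  moreover have "v \<notin> e" if "e \<in> set (path_edges (p1 @ [x])) \<or> e \<in> set (path_edges (y # p2))" for e
    using that path_edges_subset[of e "p1 @ [x]"] path_edges_subset[of e "y # p2"] assms by auto
  ultimately show ?thesis by auto
qed

lemma path_interior_two_edges:
  assumes "distinct p" "v \<in> path_interior p"
  obtains e f where "e \<noteq> f" "{e \<in> set (path_edges p). v \<in> e} = {e, f}"
proof -
  obtain p1 x y p2 where p: "p = p1 @ x # v # y # p2" using path_interiorE[OF assms(2)] .
  then have "{x, v} \<noteq> {v, y}" using assms(1) by (auto simp: doubleton_eq_iff)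
  moreover have "{e \<in> set (path_edges p). v \<in> e} = {{x, v}, {v, y}}"
    using path_edges_at_interior assms(1) unfolding p .
  ultimately show ?thesis by (rule that)
qed

lemma path_interior_subset: "path_interior p \<subseteq> set p"
  by (cases p) (auto simp: path_interior_def dest: in_set_butlastD)

lemma path_vertex_cases:
  assumes "v \<in> set p"
  shows "v = hd p \<or> v = last p \<or> v \<in> path_interior p"
proof -
  obtain x t where p: "p = x # t" using assms by (cases p) auto
  show ?thesis
  proof (cases "t = []")
    case False
    then have "set t = insert (last t) (set (butlast t))"
      by (metis append_butlast_last_id list.simps(15) rotate1.simps(2) set_rotate1)
    then show ?thesis using assms p False by (auto simp: path_interior_def)
  qed (use assms p in auto)
qed

section \<open>Leaf-paths\<close>

lemma leaf_incident_unique: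
  assumes "v \<in> leaves V E" "e \<in> E" "f \<in> E" "v \<in> e" "v \<in> f"
  shows "e = f"
proof -
  have "card (incident_edges E v) = 1" using assms by (simp add: leaves_def node_degree_def)
  then obtain g where "incident_edges E v = {g}" by (auto simp: card_1_singleton_iff)
  moreover have "e \<in> incident_edges E v" "f \<in> incident_edges E v"
    using assms by (auto simp: incident_edges_def)
  ultimately show ?thesis by simp
qed

lemma leaf_path_rev: "leaf_path V E (rev p) \<longleftrightarrow> leaf_path V E p"
  by (auto simp: leaf_path_def path_in_rev path_edges_rev hd_rev last_rev)

text \<open>If there is a third node, the second node lies on two different edges and is no leaf, so
  the leaf on the first edge is the first node. A single edge is covered by the extra clause in
  \<open>leaf_path\<close>.\<close>

lemma leaf_path_hd_leaf:
  assumes "leaf_path V E p"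
  shows "hd p \<in> leaves V E"
proof -
  obtain x y q where p: "p = x # y # q"
    using assms unfolding leaf_path_def by (metis path_edges.elims)
  show ?thesis
  proof (cases q)
    case Nil
    then show ?thesis using assms p by (auto simp: leaf_path_def)
  next
    case (Cons t q')
    have E: "{x, y} \<in> E" "{y, t} \<in> E" and d: "x \<noteq> t" "x \<noteq> y"
      using assms p Cons by (auto simp: leaf_path_def path_in_def)
    have "y \<notin> leaves V E"
    proof
      assume "y \<in> leaves V E"
      then have "{x, y} = {y, t}" using E by (intro leaf_incident_unique[of y V E]) auto
      then show False using d by (auto simp: doubleton_eq_iff)
    qed
    moreover have "\<exists>v\<in>leaves V E. v \<in> {x, y}"
      using assms p by (auto simp: leaf_path_def leaf_edge_def)
    ultimately show ?thesis using p by auto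
  qed
qed

lemma leaf_path_last_leaf:
  assumes "leaf_path V E p"
  shows "last p \<in> leaves V E"
  using leaf_path_hd_leaf[of V E "rev p"] assms
  by (simp add: leaf_path_rev hd_rev)

lemma leaf_pathI:
  assumes "path_in V E p" "path_edges p \<noteq> []" "hd p \<in> leaves V E" "last p \<in> leaves V E"
  shows "leaf_path V E p"
proof -
  have E: "set (path_edges p) \<subseteq> E" using assms path_edges_in_graph[of E p] by (simp add: path_in_def)
  have hd: "hd q \<in> hd (path_edges q)" if "path_edges q \<noteq> []" for q :: "'a list"
    using that by (cases q rule: path_edges.cases) auto
  have "last p \<in> last (path_edges p)"
    using hd[of "rev p"] assms(2) by (simp add: path_edges_rev hd_rev)
  moreover have "set p \<subseteq> leaves V E" if "length (path_edges p) = 1"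
    using that assms(3,4) by (cases p rule: path_edges.cases; cases "tl (tl p)") auto
  ultimately show ?thesis
    using assms hd[of p] E unfolding leaf_path_def leaf_edge_def
    by (meson hd_in_set last_in_set subsetD)
qed

lemma internal_not_leaf: "v \<in> internal_nodes V E \<Longrightarrow> v \<notin> leaves V E"
  by (simp add: internal_nodes_def leaves_def)

text \<open>Both ends of a leaf-path are leaves, so an internal node of the tree cannot be an
  end.\<close>

lemma leaf_path_internal_iff:
  assumes "leaf_path V E p" "v \<in> internal_nodes V E"
  shows "v \<in> path_interior p \<longleftrightarrow> v \<in> set p"
  using path_vertex_cases[of v p] path_interior_subset[of p] leaf_path_hd_leaf[OF assms(1)]
    leaf_path_last_leaf[OF assms(1)] internal_not_leaf[OF assms(2)] by auto

section \<open>The polytope\<close>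

text \<open>The node constraints range over all orderings of the three incident edges; this reduces
  a check over them to six cases.\<close>

lemma triple_permutations:
  assumes "distinct [a, b, c]" "distinct [x, y, t]" "{a, b, c} = {x, y, t}"
  shows "x = a \<and> y = b \<and> t = c \<or> x = a \<and> y = c \<and> t = b \<or> x = b \<and> y = a \<and> t = c \<or>
    x = b \<and> y = c \<and> t = a \<or> x = c \<and> y = a \<and> t = b \<or> x = c \<and> y = b \<and> t = a"
proof -
  have "x \<in> {a, b, c}" "y \<in> {a, b, c}" "t \<in> {a, b, c}" using assms(3) by auto
  then show ?thesis using assms(2) by auto
qed

lemma no_internal_node_single_edge: "internal_nodes V {e} = {}"
proof -
  have "incident_edges {e} v = (if v \<in> e then {e} else {})" for v
    by (auto simp: incident_edges_def)
  then have "card (incident_edges {e} v) \<noteq> 3" for v by simp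
  then show ?thesis by (simp add: internal_nodes_def node_degree_def)
qed

text \<open>One description for both cases of \<open>Q_poly\<close>. For a single edge the node
  condition is vacuous; otherwise the unit box follows from the node constraints. One triangle
  inequality suffices because all orderings of the edges are considered.\<close>

lemma mem_Q_poly_iff:
  assumes "tree_1_3 V E"
  shows "(w, z) \<in> Q_poly V E \<longleftrightarrow> (w, z) \<in> coord_space V E \<and> (\<forall>e. 0 \<le> w $ e \<and> w $ e \<le> 1) \<and>
    (\<forall>v\<in>internal_nodes V E. \<forall>a b c. distinct [a, b, c] \<and> incident_edges E v = {a, b, c} \<longrightarrow>
       w $ a \<le> w $ b + w $ c \<and> w $ a + w $ b + w $ c = 2 * z $ v \<and> z $ v \<le> 1)"
    (is "_ \<longleftrightarrow> _ \<and> _ \<and> ?loc")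
proof (cases "\<exists>e. E = {e}")
  case True
  then obtain e where e: "E = {e}" by blast
  have "?loc" using no_internal_node_single_edge[of V e] e by simp
  moreover have "(w, z) \<in> Q_poly V E \<longleftrightarrow>
      (w, z) \<in> coord_space V E \<and> (\<forall>e\<in>E. 0 \<le> w $ e \<and> w $ e \<le> 1)"
    unfolding Q_poly_def if_P[OF True] mem_Collect_eq prod.case by blast
  ultimately show ?thesis
    using Q_poly_bounds(1)[OF assms, of w z] by blast
next
  case False
  let ?full = "\<forall>v\<in>internal_nodes V E. \<forall>a b c.
      distinct [a, b, c] \<and> incident_edges E v = {a, b, c} \<longrightarrow>
        w $ a \<le> w $ b + w $ c \<and> w $ b \<le> w $ a + w $ c \<and> w $ c \<le> w $ a + w $ b \<and>
        w $ a + w $ b + w $ c = 2 * z $ v \<and> z $ v \<le> 1"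
  have Q: "(w, z) \<in> Q_poly V E \<longleftrightarrow> (w, z) \<in> coord_space V E \<and> ?full"
    unfolding Q_poly_def if_not_P[OF False] mem_Collect_eq prod.case by blast
  have full_if_loc: ?full if l: ?loc
  proof (intro ballI allI impI)
    fix v a b c
    assume v: "v \<in> internal_nodes V E" and abc: "distinct [a, b, c] \<and> incident_edges E v = {a, b, c}"
    have "w $ a \<le> w $ b + w $ c \<and> w $ a + w $ b + w $ c = 2 * z $ v \<and> z $ v \<le> 1"
      using l[rule_format, OF v abc] .
    moreover have bac: "distinct [b, a, c] \<and> incident_edges E v = {b, a, c}"
      and cab: "distinct [c, a, b] \<and> incident_edges E v = {c, a, b}"
      using abc by auto
    have "w $ b \<le> w $ a + w $ c" "w $ c \<le> w $ a + w $ b"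
      using l[rule_format, OF v bac] l[rule_format, OF v cab] by simp_all
    ultimately show "w $ a \<le> w $ b + w $ c \<and> w $ b \<le> w $ a + w $ c \<and> w $ c \<le> w $ a + w $ b \<and>
        w $ a + w $ b + w $ c = 2 * z $ v \<and> z $ v \<le> 1" by blast
  qed
  have loc_if_full: ?loc if f: ?full
  proof (intro ballI allI impI)
    fix v a b c
    assume v: "v \<in> internal_nodes V E" and abc: "distinct [a, b, c] \<and> incident_edges E v = {a, b, c}"
    show "w $ a \<le> w $ b + w $ c \<and> w $ a + w $ b + w $ c = 2 * z $ v \<and> z $ v \<le> 1"
      using f[rule_format, OF v abc] by simp
  qed
  have "?full \<longleftrightarrow> ?loc"
  proof
    assume ?full then show ?loc by (rule loc_if_full)
  next
    assume ?loc then show ?full by (rule full_if_loc)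
  qed
  moreover have "(w, z) \<in> Q_poly V E \<longrightarrow> (\<forall>e. 0 \<le> w $ e \<and> w $ e \<le> 1)"
    using Q_poly_bounds(1)[OF assms, of w z] by blast
  ultimately show ?thesis using Q by argo
qed

lemma Q_poly_node_constraints:
  assumes "tree_1_3 V E" "(w, z) \<in> Q_poly V E" "v \<in> internal_nodes V E"
    and "distinct [a, b, c]" "incident_edges E v = {a, b, c}"
  shows "w $ a \<le> w $ b + w $ c" "w $ a + w $ b + w $ c = 2 * z $ v" "z $ v \<le> 1"
proof -
  have "\<forall>v\<in>internal_nodes V E. \<forall>a b c. distinct [a, b, c] \<and> incident_edges E v = {a, b, c} \<longrightarrow>
       w $ a \<le> w $ b + w $ c \<and> w $ a + w $ b + w $ c = 2 * z $ v \<and> z $ v \<le> 1"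
    using assms(2) unfolding mem_Q_poly_iff[OF assms(1)] by (elim conjE)
  from this[rule_format, OF assms(3) conjI[OF assms(4,5)]]
  show "w $ a \<le> w $ b + w $ c" "w $ a + w $ b + w $ c = 2 * z $ v" "z $ v \<le> 1" by simp_all
qed

lemma Q_poly_coord_space: "(w, z) \<in> Q_poly V E \<Longrightarrow> (w, z) \<in> coord_space V E"
  by (auto simp: Q_poly_def split: if_splits)

lemma internal_node_triple:
  assumes "v \<in> internal_nodes V E"
  obtains a b c where "distinct [a, b, c]" "incident_edges E v = {a, b, c}"
proof -
  have "card (incident_edges E v) = 3" using assms by (simp add: internal_nodes_def node_degree_def)
  then obtain a where "a \<in> incident_edges E v" by fastforce
  then obtain b c where "distinct [a, b, c]" "incident_edges E v = {a, b, c}"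
    by (rule internal_node_edges[OF assms])
  then show ?thesis by (rule that)
qed

lemma Q_poly_node_value:
  assumes "tree_1_3 V E" "(w, z) \<in> Q_poly V E" "v \<in> internal_nodes V E"
  shows "z $ v = (\<Sum>e\<in>incident_edges E v. w $ e) / 2"
proof -
  obtain a b c where abc: "distinct [a, b, c]" "incident_edges E v = {a, b, c}"
    using internal_node_triple[OF assms(3)] .
  then have "w $ a + w $ b + w $ c = 2 * z $ v"
    by (rule Q_poly_node_constraints[OF assms])
  then show ?thesis using abc by auto
qed

text \<open>At internal nodes \<open>z\<close> is half the sum of the incident weights, and
  elsewhere it vanishes by \<open>coord_space\<close>.\<close>

lemma Q_poly_eqI:
  assumes T: "tree_1_3 V E" and x: "(w, z) \<in> Q_poly V E" and y: "(w, z') \<in> Q_poly V E"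
  shows "z = z'"
proof -
  have "(w, z) \<in> coord_space V E" "(w, z') \<in> coord_space V E"
    using x y by (auto intro: Q_poly_coord_space)
  then have "z $ v = z' $ v" for v
    using Q_poly_node_value[OF T x, of v] Q_poly_node_value[OF T y, of v]
    by (cases "v \<in> internal_nodes V E") (auto simp: coord_space_def)
  then show ?thesis by (simp add: vec_eq_iff)
qed

section \<open>0/1 points are extreme\<close>

lemma convex_combination_at_bound:
  fixes a b u :: real
  assumes "0 \<le> a" "a \<le> 1" "0 \<le> b" "b \<le> 1" "0 < u" "u < 1"
    and "(1 - u) * a + u * b = 0 \<or> (1 - u) * a + u * b = 1"
  shows "a = b"
  using assms(7)
proof
  assume "(1 - u) * a + u * b = 0"
  moreover have "(1 - u) * a \<ge> 0" "u * b \<ge> 0" using assms by auto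
  ultimately have "(1 - u) * a = 0" "u * b = 0" by linarith+
  then show ?thesis using assms by simp
next
  assume "(1 - u) * a + u * b = 1"
  then have "(1 - u) * (1 - a) + u * (1 - b) = 0" by (simp add: algebra_simps)
  moreover have "(1 - u) * (1 - a) \<ge> 0" "u * (1 - b) \<ge> 0" using assms by auto
  ultimately have "(1 - u) * (1 - a) = 0" "u * (1 - b) = 0" by linarith+
  then show ?thesis using assms by simp
qed

text \<open>A coordinate at an end of the unit interval must agree at both ends of a segment through
  the point. So the \<open>w\<close>-parts coincide, and they determine the
  \<open>z\<close>-parts.\<close>

lemma integral_imp_extreme_point:
  assumes T: "tree_1_3 V E" and x: "(w, z) \<in> Q_poly V E" and int: "\<And>e. w $ e = 0 \<or> w $ e = 1"
  shows "(w, z) extreme_point_of Q_poly V E"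
  unfolding extreme_point_of_def
proof (intro conjI ballI x notI)
  fix p q assume p: "p \<in> Q_poly V E" and q: "q \<in> Q_poly V E" and seg: "(w, z) \<in> open_segment p q"
  obtain p1 p2 q1 q2 where pq: "p = (p1, p2)" "q = (q1, q2)" by (cases p, cases q)
  obtain u where ne: "p \<noteq> q" and u: "0 < u" "u < 1" "(w, z) = (1 - u) *\<^sub>R p + u *\<^sub>R q"
    using seg by (auto simp: in_segment)
  have "p1 $ e = q1 $ e" for e
  proof (rule convex_combination_at_bound[of _ _ u])
    show "(1 - u) * p1 $ e + u * q1 $ e = 0 \<or> (1 - u) * p1 $ e + u * q1 $ e = 1"
      using int[of e] u pq by simp
  qed (use Q_poly_bounds(1)[OF T] p q pq u in auto)
  then have "p1 = q1" by (simp add: vec_eq_iff)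
  then show False using Q_poly_eqI[OF T, of p1 p2 q2] p q pq ne by simp
qed

text \<open>At an internal node either exactly one path passes, using two of the three edges, or
  none does. So the weights there sum to 2 or 0, matching \<open>z\<close>.\<close>

lemma char_vec_in_Q_poly:
  assumes T: "tree_1_3 V E" and H: "disjoint_leaf_paths V E H"
  shows "char_vec V E H \<in> Q_poly V E"
proof -
  define w :: "real ^ 'a set" where "w = fst (char_vec V E H)"
  define z :: "real ^ 'a" where "z = snd (char_vec V E H)"
  have w: "w $ e = (if e \<in> E \<and> (\<exists>p\<in>H. e \<in> set (path_edges p)) then 1 else 0)" for e
    by (simp add: w_def char_vec_def)
  have z: "z $ v = (if v \<in> internal_nodes V E \<and> (\<exists>p\<in>H. v \<in> path_interior p) then 1 else 0)" for v
    by (simp add: z_def char_vec_def)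
  have lp: "leaf_path V E p" if "p \<in> H" for p using H that by (auto simp: disjoint_leaf_paths_def)
  have sum: "w $ a + w $ b + w $ c = 2 * z $ v"
    if v: "v \<in> internal_nodes V E" and abc: "distinct [a, b, c]" "incident_edges E v = {a, b, c}"
    for v a b c
  proof (cases "\<exists>p\<in>H. v \<in> path_interior p")
    case True
    then obtain p where p: "p \<in> H" "v \<in> path_interior p" by blast
    have "path_in V E p" using lp[OF p(1)] by (simp add: leaf_path_def)
    then have pE: "set (path_edges p) \<subseteq> E" "distinct p"
      using path_edges_in_graph[of E p] by (auto simp: path_in_def)
    obtain e f where ef: "e \<noteq> f" "{e \<in> set (path_edges p). v \<in> e} = {e, f}"
      using path_interior_two_edges[OF pE(2) p(2)] .
    have vp: "v \<in> set p" using subsetD[OF path_interior_subset p(2)] .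
    \<comment> \<open>By disjointness, \<open>p\<close> is the only path of \<open>H\<close> with an
      edge at \<open>v\<close>.\<close>
    have cov: "w $ g = (if g \<in> {e, f} then 1 else 0)" if g: "g \<in> incident_edges E v" for g
    proof -
      have "q = p" if "q \<in> H" "g \<in> set (path_edges q)" for q
      proof -
        have "v \<in> set q" using path_edges_subset[OF that(2)] g by (auto simp: incident_edges_def)
        then have "\<not> disjnt (set q) (set p)" using vp by (auto simp: disjnt_iff)
        then show ?thesis
          using H that(1) p(1) unfolding disjoint_leaf_paths_def pairwise_def by blast
      qed
      then have "(\<exists>q\<in>H. g \<in> set (path_edges q)) \<longleftrightarrow> g \<in> {e \<in> set (path_edges p). v \<in> e}"
        using p(1) g by (auto simp: incident_edges_def)
      then show ?thesis using g w[of g] ef(2) by (simp add: incident_edges_def)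
    qed
    have "{e, f} \<subseteq> incident_edges E v"
      unfolding ef(2)[symmetric] using pE by (auto simp: incident_edges_def)
    then have "{e, f} \<subseteq> {a, b, c}" using abc by simp
    then have "w $ a + w $ b + w $ c = 2"
      using cov abc ef(1) by auto
    then show ?thesis using z[of v] v True by simp
  next
    case False
    have "w $ g = 0" if g: "g \<in> incident_edges E v" for g
    proof -
      have "g \<notin> set (path_edges p)" if "p \<in> H" for p
        using False that leaf_path_internal_iff[OF lp[OF that] v] g path_edges_subset[of g p]
        by (auto simp: incident_edges_def)
      then show ?thesis using w[of g] by auto
    qed
    then show ?thesis using abc z[of v] False by simp
  qed
  have w01: "w $ e = 0 \<or> w $ e = 1" for e using w[of e] by auto
  have z01: "z $ v = 0 \<or> z $ v = 1" for v using z[of v] by auto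
  have "(w, z) \<in> coord_space V E" using w z by (simp add: coord_space_def)
  \<comment> \<open>A violation would need weights 1, 0, 0, whose sum is odd.\<close>
  moreover have "w $ a \<le> w $ b + w $ c"
    if "v \<in> internal_nodes V E" "distinct [a, b, c]" "incident_edges E v = {a, b, c}" for v a b c
    using sum[OF that] w01[of a] w01[of b] w01[of c] z01[of v] by auto
  moreover have "0 \<le> w $ e \<and> w $ e \<le> 1" for e using w01[of e] by auto
  moreover have "z $ v \<le> 1" for v using z01[of v] by auto
  ultimately have "(w, z) \<in> Q_poly V E"
    unfolding mem_Q_poly_iff[OF T] using sum by simp
  then show ?thesis by (simp add: w_def z_def)
qed

section \<open>Integral points are collections of leaf-paths\<close>

text \<open>An internal first node would have a second edge in \<open>F\<close>. Its other end
  either prolongs the path at the front or already lies on it and closes a cycle.\<close>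

lemma maximal_path_hd_leaf:
  assumes T: "tree_1_3 V E" and F: "F \<subseteq> E"
    and deg: "\<And>v f. v \<in> internal_nodes V E \<Longrightarrow> f \<in> F \<Longrightarrow> v \<in> f \<Longrightarrow> \<exists>g\<in>F. v \<in> g \<and> g \<noteq> f"
    and p: "path_in V F p" "path_edges p \<noteq> []"
    and max: "\<And>v. \<not> path_in V F (v # p)"
  shows "hd p \<in> leaves V E"
proof (rule ccontr)
  assume nl: "hd p \<notin> leaves V E"
  obtain x y q where pq: "p = x # y # q" using p(2) by (metis path_edges.elims)
  have xV: "x \<in> V" and xy: "{x, y} \<in> F" using p pq by (auto simp: path_in_def)
  then have "x \<in> internal_nodes V E"
    using nl T pq by (auto simp: tree_1_3_def leaves_def internal_nodes_def)
  then obtain g where g: "g \<in> F" "x \<in> g" "g \<noteq> {x, y}" using deg xy by blast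
  have gE: "g \<subseteq> V" "card g = 2"
    using g F T by (auto simp: tree_1_3_def tree_def simple_graph_def)
  then obtain t where t: "g = {x, t}" "t \<noteq> x" using g(2) by (auto simp: card_2_iff)
  have ty: "t \<noteq> y" using g t by auto
  have "t \<in> set p"
  proof (rule ccontr)
    assume "t \<notin> set p"
    then have "path_in V F (t # p)" using p pq t g gE by (auto simp: path_in_def insert_commute)
    then show False using max by blast
  qed
  then obtain q1 q2 where q: "q = q1 @ t # q2" using pq t ty by (auto simp: in_set_conv_decomp)
  \<comment> \<open>The initial segment of \<open>p\<close> up to \<open>t\<close>; the edge
    \<open>g\<close> joins its two ends.\<close>
  let ?c = "x # y # q1 @ [t]"
  have "p = ?c @ q2" using pq q by simp
  then have "path_in V F ?c"
    using p(1) successively_append_iff[of "\<lambda>x y. {x, y} \<in> F" ?c q2] by (auto simp: path_in_def)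
  then have "path_in V E ?c"
    using F unfolding path_in_def path_edges_in_graph by blast
  then have "cycle_in V E ?c" using g F t by (auto simp: cycle_in_def insert_commute)
  then show False using T by (auto simp: tree_1_3_def tree_def)
qed

text \<open>A longest path in \<open>F\<close> through \<open>e\<close> cannot be prolonged at
  either end, so both ends are leaves. Such a path exists since no path has more nodes than
  \<open>V\<close>.\<close>

lemma edge_in_leaf_path:
  assumes T: "tree_1_3 V E" and F: "F \<subseteq> E"
    and deg: "\<And>v f. v \<in> internal_nodes V E \<Longrightarrow> f \<in> F \<Longrightarrow> v \<in> f \<Longrightarrow> \<exists>g\<in>F. v \<in> g \<and> g \<noteq> f"
    and e: "e \<in> F"
  obtains p where "leaf_path V E p" "set (path_edges p) \<subseteq> F" "e \<in> set (path_edges p)"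
proof -
  have "e \<subseteq> V" "card e = 2" "finite V"
    using e F T by (auto simp: tree_1_3_def tree_def simple_graph_def)
  then obtain u v where uv: "e = {u, v}" "u \<noteq> v" by (auto simp: card_2_iff)
  define P where "P p \<longleftrightarrow> path_in V F p \<and> e \<in> set (path_edges p)" for p
  have "P [u, v]" using uv e \<open>e \<subseteq> V\<close> by (auto simp: P_def path_in_def)
  moreover have bound: "length p \<le> card V" if "P p" for p
    using that \<open>finite V\<close> by (metis P_def card_mono distinct_card path_in_def)
  ultimately obtain p where p: "P p" and max: "\<And>q. P q \<Longrightarrow> length q \<le> length p"
    using ex_has_greatest_nat[of P "[u, v]" length "Suc (card V)"] by (metis less_Suc_eq_le)
  have P_rev: "P (rev q) \<longleftrightarrow> P q" for q by (simp add: P_def path_in_rev path_edges_rev)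
  have P_Cons: "P (x # q)" if "P q" "path_in V F (x # q)" for x q
    using that by (cases q) (auto simp: P_def)
  \<comment> \<open>Stated for every path of maximal length, so that applying it to
    \<open>rev p\<close> settles the last node.\<close>
  have ends: "hd q \<in> leaves V E" if "P q" "length q = length p" for q
  proof (rule maximal_path_hd_leaf[OF T F deg])
    show "path_in V F q" "path_edges q \<noteq> []" using that by (auto simp: P_def)
    show "\<not> path_in V F (x # q)" for x using P_Cons[OF that(1)] max[of "x # q"] that(2) by auto
  qed
  have "path_in V E p" using p F unfolding P_def path_in_def path_edges_in_graph by blast
  moreover have "path_edges p \<noteq> []" using p by (auto simp: P_def)
  moreover have "last p \<in> leaves V E" using ends[of "rev p"] p P_rev by (simp add: hd_rev)
  ultimately have "leaf_path V E p" using ends[OF p] by (intro leaf_pathI) auto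
  moreover have "set (path_edges p) \<subseteq> F"
    using p path_edges_in_graph[of F p] by (simp add: P_def path_in_def)
  ultimately show ?thesis using that p by (auto simp: P_def)
qed

text \<open>At an internal node \<open>p\<close> already uses the at most two edges of
  \<open>F\<close>; at a leaf there is only one edge at all.\<close>

lemma leaf_path_absorbs_edges:
  assumes p: "leaf_path V E p" "set (path_edges p) \<subseteq> F" and F: "F \<subseteq> E"
    and deg: "\<And>v. v \<in> internal_nodes V E \<Longrightarrow> card {f \<in> F. v \<in> f} \<le> 2" and fin: "finite F"
    and f: "f \<in> F" "v \<in> f" "v \<in> set p"
    and T: "tree_1_3 V E"
  shows "f \<in> set (path_edges p)"
proof -
  have pV: "path_in V E p" using p by (simp add: leaf_path_def)
  show ?thesis
  proof (cases "v \<in> internal_nodes V E")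
    case True
    then have "v \<in> path_interior p" using leaf_path_internal_iff[OF p(1)] f(3) by blast
    then obtain e g where eg: "e \<noteq> g" "{e \<in> set (path_edges p). v \<in> e} = {e, g}"
      using path_interior_two_edges pV by (metis path_in_def)
    have "{e, g} \<subseteq> {f \<in> F. v \<in> f}" unfolding eg(2)[symmetric] using p(2) by blast
    moreover have "card {f \<in> F. v \<in> f} \<le> card {e, g}" using deg[OF True] eg(1) by simp
    ultimately have "{e, g} = {f \<in> F. v \<in> f}" using fin by (intro card_seteq) auto
    then show ?thesis using f eg(2) by blast
  next
    case False
    have "v \<in> leaves V E"
      using False T f(3) pV by (auto simp: tree_1_3_def leaves_def internal_nodes_def path_in_def)
    moreover obtain e where "e \<in> set (path_edges p)" "v \<in> e"
    proof -
      have "path_edges p \<noteq> []" using p(1) by (simp add: leaf_path_def)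
      then have "\<forall>v\<in>set p. \<exists>e\<in>set (path_edges p). v \<in> e"
      proof (induction p rule: path_edges.induct)
        case (1 x y p)
        then show ?case by (cases p) auto
      qed auto
      then show ?thesis using that f(3) by blast
    qed
    ultimately show ?thesis
      using leaf_incident_unique[of v V E f e] f p(2) F by blast
  qed
qed

text \<open>Every edge of \<open>F\<close> lies on a leaf-path within \<open>F\<close>, and two such
  paths that meet have the same nodes. Choosing one path for each node set gives a disjoint
  collection covering \<open>F\<close>.\<close>

lemma leaf_path_decomposition:
  assumes T: "tree_1_3 V E" and F: "F \<subseteq> E" and fin: "finite F"
    and deg: "\<And>v. v \<in> internal_nodes V E \<Longrightarrow> card {f \<in> F. v \<in> f} = 0 \<or> card {f \<in> F. v \<in> f} = 2"
  obtains H where "disjoint_leaf_paths V E H" "(\<Union>p\<in>H. set (path_edges p)) = F"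
proof -
  define K where "K = {p. leaf_path V E p \<and> set (path_edges p) \<subseteq> F}"
  have other: "\<exists>g\<in>F. v \<in> g \<and> g \<noteq> f"
    if "v \<in> internal_nodes V E" "f \<in> F" "v \<in> f" for v f
  proof (rule ccontr)
    assume "\<not> ?thesis"
    then have "{f \<in> F. v \<in> f} = {f}" using that by blast
    then show False using deg[OF that(1)] by simp
  qed
  have absorb: "f \<in> set (path_edges p)" if "p \<in> K" "f \<in> F" "v \<in> f" "v \<in> set p" for p f v
  proof (rule leaf_path_absorbs_edges[OF _ _ F _ fin that(2-4) T])
    show "leaf_path V E p" "set (path_edges p) \<subseteq> F" using that(1) by (auto simp: K_def)
    show "card {f \<in> F. v \<in> f} \<le> 2" if "v \<in> internal_nodes V E" for v
      using deg[OF that] by linarith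
  qed
  \<comment> \<open>By absorption the node set of \<open>p\<close> is closed under adjacency in
    \<open>F\<close>, so \<open>q\<close> cannot leave it.\<close>
  have sub: "set q \<subseteq> set p" if pq: "p \<in> K" "q \<in> K" and v: "v \<in> set p" "v \<in> set q" for p q v
  proof (rule successively_closed_subset[OF _ _ v(2,1)])
    show "successively (\<lambda>x y. {x, y} \<in> F) q" using pq path_edges_in_graph[of F q] by (simp add: K_def)
    show "x \<in> set p \<longleftrightarrow> y \<in> set p" if "{x, y} \<in> F" for x y
      using absorb[OF pq(1) that] path_edges_subset[of "{x, y}" p] by blast
  qed
  \<comment> \<open>The choice depends on the node set only, so a path and its reversal get the same
    representative.\<close>
  define c where "c S = (SOME p. p \<in> K \<and> set p = S)" for S
  have c: "c (set p) \<in> K \<and> set (c (set p)) = set p" if "p \<in> K" for p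
    unfolding c_def by (rule someI[of _ p]) (use that in simp)
  define H where "H = (\<lambda>p. c (set p)) ` K"
  have HK: "H \<subseteq> K" using c by (auto simp: H_def)
  have "disjnt (set p) (set q)" if pq: "p \<in> H" "q \<in> H" and ne: "p \<noteq> q" for p q
  proof (rule ccontr)
    assume "\<not> ?thesis"
    then have "set p = set q" using sub pq HK by (meson disjnt_iff subset_antisym subset_iff)
    moreover have "c (set p) = p" "c (set q) = q" using pq c by (auto simp: H_def)
    ultimately show False using ne by metis
  qed
  then have "disjoint_leaf_paths V E H"
    using HK by (auto simp: disjoint_leaf_paths_def pairwise_def K_def)
  moreover have "(\<Union>p\<in>H. set (path_edges p)) = F"
  proof
    show "(\<Union>p\<in>H. set (path_edges p)) \<subseteq> F" using HK by (auto simp: K_def)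
    show "F \<subseteq> (\<Union>p\<in>H. set (path_edges p))"
    proof
      fix e assume e: "e \<in> F"
      obtain p where p: "p \<in> K" "e \<in> set (path_edges p)"
        using edge_in_leaf_path[OF T F other e] by (auto simp: K_def)
      have "card e = 2" using e F T by (auto simp: tree_1_3_def tree_def simple_graph_def)
      then obtain v where v: "v \<in> e" by fastforce
      \<comment> \<open>The representative may differ from \<open>p\<close>, but it has the same
        nodes and hence absorbs \<open>e\<close>.\<close>
      then have "v \<in> set (c (set p))" using p path_edges_subset[of e p] c by blast
      then have "e \<in> set (path_edges (c (set p)))" using absorb c p(1) e v by blast
      then show "e \<in> (\<Union>p\<in>H. set (path_edges p))" using p(1) by (auto simp: H_def)
    qed
  qed
  ultimately show ?thesis by (rule that)
qed

text \<open>The edges of weight 1 form \<open>F\<close>. The degree of \<open>F\<close> at an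
  internal node is \<open>2 * z $ v\<close>, at most 2, and degree 1 would violate a triangle
  inequality.\<close>

lemma integral_imp_char_vec:
  fixes V :: "'v::finite set"
  assumes T: "tree_1_3 V E" and x: "(w, z) \<in> Q_poly V E" and int: "\<And>e. w $ e = 0 \<or> w $ e = 1"
  shows "\<exists>H. disjoint_leaf_paths V E H \<and> char_vec V E H = (w, z)"
proof -
  define F where "F = {e. w $ e = 1}"
  have cs: "(w, z) \<in> coord_space V E" using Q_poly_coord_space[OF x] .
  then have FE: "F \<subseteq> E" by (force simp: F_def coord_space_def)
  have "card {f \<in> F. v \<in> f} = 0 \<or> card {f \<in> F. v \<in> f} = 2" if v: "v \<in> internal_nodes V E" for v
  proof -
    have "(\<Sum>e\<in>incident_edges E v. w $ e) = (\<Sum>e\<in>incident_edges E v. if e \<in> F then 1 else 0)"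
      using int by (intro sum.cong) (auto simp: F_def)
    also have "\<dots> = real (card (incident_edges E v \<inter> F))"
      by (simp add: sum.If_cases)
    also have "incident_edges E v \<inter> F = {f \<in> F. v \<in> f}" using FE by (auto simp: incident_edges_def)
    finally have s: "real (card {f \<in> F. v \<in> f}) = 2 * z $ v"
      using Q_poly_node_value[OF T x v] by simp
    then have le: "card {f \<in> F. v \<in> f} \<le> 2" using Q_poly_bounds(2)[OF T x, of v] by linarith
    have "card {f \<in> F. v \<in> f} \<noteq> 1"
    proof
      assume "card {f \<in> F. v \<in> f} = 1"
      then obtain f where f: "{f \<in> F. v \<in> f} = {f}" by (auto simp: card_1_singleton_iff)
      then have "f \<in> incident_edges E v" using FE by (auto simp: incident_edges_def)
      then obtain b c where bc: "distinct [f, b, c]" "incident_edges E v = {f, b, c}"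
        using internal_node_edges[OF v] by blast
      have "b \<in> incident_edges E v" "c \<in> incident_edges E v" using bc by auto
      then have "b \<notin> F" "c \<notin> F" using f bc(1) by (auto simp: incident_edges_def)
      then have "w $ b = 0" "w $ c = 0" using int by (auto simp: F_def)
      moreover have "w $ f \<le> w $ b + w $ c"
        by (rule Q_poly_node_constraints[OF T x v bc])
      moreover have "f \<in> F" using f by auto
      ultimately show False by (simp add: F_def)
    qed
    then show ?thesis using le by linarith
  qed
  then obtain H where H: "disjoint_leaf_paths V E H" "(\<Union>p\<in>H. set (path_edges p)) = F"
    by (rule leaf_path_decomposition[OF T FE finite])
  obtain w' z' where wz: "char_vec V E H = (w', z')" by fastforce
  have "w' $ e = w $ e" for e
  proof -
    have "w' $ e = (if e \<in> E \<and> (\<exists>p\<in>H. e \<in> set (path_edges p)) then 1 else 0)"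
      using wz by (auto simp: char_vec_def)
    moreover have "(\<exists>p\<in>H. e \<in> set (path_edges p)) \<longleftrightarrow> e \<in> F" using H(2) by blast
    ultimately show ?thesis using int[of e] FE by (auto simp: F_def)
  qed
  then have "w' = w" by (simp add: vec_eq_iff)
  \<comment> \<open>Only \<open>w' = w\<close> was compared; \<open>z' = z\<close> follows because
    both points lie in the polytope.\<close>
  moreover have "(w', z') \<in> Q_poly V E" using char_vec_in_Q_poly[OF T H(1)] wz by simp
  ultimately show ?thesis using Q_poly_eqI[OF T x, of z'] wz H(1) by auto
qed

section \<open>Extreme points are integral\<close>

text \<open>Moving \<open>w\<close> along \<open>d\<close> keeps every constraint at \<open>v\<close> tight that is tight for \<open>w\<close>; ranging over
  all orderings of the incident edges covers the three triangle inequalities.\<close>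

definition tangent_at :: "'v set set \<Rightarrow> ('v set \<Rightarrow> real) \<Rightarrow> ('v set \<Rightarrow> real) \<Rightarrow> 'v \<Rightarrow> bool" where
  "tangent_at E w d v \<longleftrightarrow> (\<forall>a b c. distinct [a, b, c] \<and> incident_edges E v = {a, b, c} \<longrightarrow>
     (w a = w b + w c \<longrightarrow> d a = d b + d c) \<and> (w a + w b + w c = 2 \<longrightarrow> d a + d b + d c = 0))"

text \<open>The weights \<open>x\<close>, \<open>y\<close>, \<open>t\<close> lie in the tetrahedron,
  and \<delta> is a prescribed change of \<open>x\<close>. The facets \<open>x = y + t\<close> and
  \<open>x + y + t = 2\<close> prescribe \<beta> + \<gamma>, the other two prescribe \<beta> -
  \<gamma>, each as \<delta> or its negative.\<close>

lemma tangent_extension: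
  fixes x y t \<delta> :: real
  assumes "x \<le> y + t" "y \<le> x + t" "t \<le> x + y" "x + y + t \<le> 2"
    and "x = 0 \<or> x = 1 \<Longrightarrow> \<delta> = 0"
  obtains \<beta> \<gamma> where "x = y + t \<Longrightarrow> \<delta> = \<beta> + \<gamma>" "y = x + t \<Longrightarrow> \<beta> = \<delta> + \<gamma>" "t = x + y \<Longrightarrow> \<gamma> = \<delta> + \<beta>"
    "x + y + t = 2 \<Longrightarrow> \<delta> + \<beta> + \<gamma> = 0" "y = 0 \<or> y = 1 \<Longrightarrow> \<beta> = 0" "t = 0 \<or> t = 1 \<Longrightarrow> \<gamma> = 0"
proof -
  let ?G = "\<lambda>\<beta> \<gamma>. (x = y + t \<longrightarrow> \<delta> = \<beta> + \<gamma>) \<and> (y = x + t \<longrightarrow> \<beta> = \<delta> + \<gamma>) \<and>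
    (t = x + y \<longrightarrow> \<gamma> = \<delta> + \<beta>) \<and> (x + y + t = 2 \<longrightarrow> \<delta> + \<beta> + \<gamma> = 0)"
  have "\<exists>\<beta> \<gamma>. ?G \<beta> \<gamma>"
  proof (cases "x = 0 \<or> x = 1")
    case True
    then have "?G 0 0" using assms(5) by simp
    then show ?thesis by blast
  next
    case False
    \<comment> \<open>The first pair would force \<open>x = 1\<close>, the second
      \<open>x = 0\<close>. So at most one value is prescribed for the sum and one for the
      difference, and putting the whole change on one edge, with a suitable sign, meets
      both.\<close>
    have "\<not> (x = y + t \<and> x + y + t = 2)" "\<not> (y = x + t \<and> t = x + y)"
      using False by linarith+
    then have "?G \<delta> 0 \<or> ?G (- \<delta>) 0 \<or> ?G 0 \<delta> \<or> ?G 0 (- \<delta>)"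
      by argo
    then show ?thesis by blast
  qed
  then obtain \<beta> \<gamma> where G: "?G \<beta> \<gamma>" by blast
  \<comment> \<open>A weight of 0 or 1 makes two facets tight, and their two equations for the
    changes leave only \<beta> = 0.\<close>
  have "\<beta> = 0" if "y = 0 \<or> y = 1"
    using that
  proof
    assume "y = 0"
    then have "x = y + t" "t = x + y" using assms by auto
    then show ?thesis using G by linarith
  next
    assume "y = 1"
    then have "y = x + t" "x + y + t = 2" using assms by auto
    then show ?thesis using G by linarith
  qed
  moreover have "\<gamma> = 0" if "t = 0 \<or> t = 1"
    using that
  proof
    assume "t = 0"
    then have "x = y + t" "y = x + t" using assms by auto
    then show ?thesis using G by linarith
  next
    assume "t = 1"
    then have "t = x + y" "x + y + t = 2" using assms by auto
    then show ?thesis using G by linarith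
  qed
  ultimately show ?thesis using that G by blast
qed

lemma tangent_at_cong:
  assumes "\<And>e. e \<in> incident_edges E v \<Longrightarrow> d e = d' e"
  shows "tangent_at E w d v \<longleftrightarrow> tangent_at E w d' v"
proof -
  have "d a = d' a \<and> d b = d' b \<and> d c = d' c" if "incident_edges E v = {a, b, c}" for a b c
    using assms that by simp
  then show ?thesis unfolding tangent_at_def by (intro all_cong1 imp_cong refl) simp
qed

lemma extend_direction_at_node:
  fixes V :: "'v::finite set"
  assumes T: "tree_1_3 V E" and x: "(w, z) \<in> Q_poly V E"
    and v: "v \<in> internal_nodes V E" and a: "a \<in> incident_edges E v"
    and d: "w $ a = 0 \<or> w $ a = 1 \<Longrightarrow> d a = 0"
  obtains d' where "d' a = d a" "\<And>e. e \<notin> incident_edges E v \<Longrightarrow> d' e = d e"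
    "\<And>e. e \<in> incident_edges E v \<Longrightarrow> w $ e = 0 \<or> w $ e = 1 \<Longrightarrow> d' e = 0"
    "tangent_at E (($) w) d' v"
proof -
  obtain b c where bc: "distinct [a, b, c]" "incident_edges E v = {a, b, c}"
    using internal_node_edges[OF v a] .
  have bac: "distinct [b, a, c]" "incident_edges E v = {b, a, c}"
    and cab: "distinct [c, a, b]" "incident_edges E v = {c, a, b}"
    using bc by auto
  have "w $ a \<le> w $ b + w $ c" "w $ b \<le> w $ a + w $ c" "w $ c \<le> w $ a + w $ b"
      "w $ a + w $ b + w $ c = 2 * z $ v" "z $ v \<le> 1"
    using Q_poly_node_constraints[OF T x v bc] Q_poly_node_constraints[OF T x v bac]
      Q_poly_node_constraints[OF T x v cab] by simp_all
  then obtain \<beta> \<gamma> where bg: "w $ a = w $ b + w $ c \<Longrightarrow> d a = \<beta> + \<gamma>"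
      "w $ b = w $ a + w $ c \<Longrightarrow> \<beta> = d a + \<gamma>" "w $ c = w $ a + w $ b \<Longrightarrow> \<gamma> = d a + \<beta>"
      "w $ a + w $ b + w $ c = 2 \<Longrightarrow> d a + \<beta> + \<gamma> = 0"
      "w $ b = 0 \<or> w $ b = 1 \<Longrightarrow> \<beta> = 0" "w $ c = 0 \<or> w $ c = 1 \<Longrightarrow> \<gamma> = 0"
    using tangent_extension[of "w $ a" "w $ b" "w $ c" "d a"] d by auto
  define d' where "d' = d(b := \<beta>, c := \<gamma>)"
  have d': "d' a = d a" "d' b = \<beta>" "d' c = \<gamma>" using bc(1) by (auto simp: d'_def)
  have "tangent_at E (($) w) d' v"
    unfolding tangent_at_def
  proof (intro allI impI)
    fix r s t assume rst: "distinct [r, s, t] \<and> incident_edges E v = {r, s, t}"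
    then have "{a, b, c} = {r, s, t}" using bc by simp
    from triple_permutations[OF bc(1) conjunct1[OF rst] this]
    show "(w $ r = w $ s + w $ t \<longrightarrow> d' r = d' s + d' t) \<and>
        (w $ r + w $ s + w $ t = 2 \<longrightarrow> d' r + d' s + d' t = 0)"
      using bg d' by (elim disjE) (auto simp: add_ac)
  qed
  moreover have "d' e = 0" if "e \<in> incident_edges E v" "w $ e = 0 \<or> w $ e = 1" for e
    using that bc(2) bg d' d by auto
  moreover have "d' e = d e" if "e \<notin> incident_edges E v" for e
    using that bc(2) by (auto simp: d'_def)
  ultimately show ?thesis using that d'(1) by blast
qed

text \<open>The direction is grown from an end of \<open>e0\<close> through the tree. At a new
  internal node the change is prescribed on one edge, and the other two edges are adjusted to
  it.\<close>

lemma tangent_direction_exists: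
  fixes V :: "'v::finite set"
  assumes T: "tree_1_3 V E" and x: "(w, z) \<in> Q_poly V E"
    and e0: "e0 \<in> E" "w $ e0 \<noteq> 0" "w $ e0 \<noteq> 1"
  obtains d where "d e0 = 1" "\<And>e. e \<notin> E \<Longrightarrow> d e = 0"
    "\<And>e. w $ e = 0 \<or> w $ e = 1 \<Longrightarrow> d e = 0"
    "\<And>v. v \<in> internal_nodes V E \<Longrightarrow> tangent_at E (($) w) d v"
proof -
  have tr: "tree V E" using T by (simp add: tree_1_3_def)
  have edge: "e \<subseteq> V" "card e = 2" if "e \<in> E" for e
    using tr that by (auto simp: tree_def simple_graph_def)
  obtain r where r: "r \<in> e0" using edge(2)[OF e0(1)] by fastforce
  then have rV: "r \<in> V" using edge(1)[OF e0(1)] by blast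
  have "\<exists>d. d e0 = 1 \<and> (\<forall>e. d e \<noteq> 0 \<longrightarrow> e \<in> E \<and> e \<inter> V \<noteq> {} \<and> w $ e \<noteq> 0 \<and> w $ e \<noteq> 1) \<and>
      (\<forall>v\<in>V. v \<in> internal_nodes V E \<longrightarrow> tangent_at E (($) w) d v)"
    (is "\<exists>d. ?inv V d")
    using tr rV
  proof (induction rule: tree_grow_induct
      [where P = "\<lambda>S. \<exists>d. d e0 = 1 \<and>
          (\<forall>e. d e \<noteq> 0 \<longrightarrow> e \<in> E \<and> e \<inter> S \<noteq> {} \<and> w $ e \<noteq> 0 \<and> w $ e \<noteq> 1) \<and>
          (\<forall>v\<in>S. v \<in> internal_nodes V E \<longrightarrow> tangent_at E (($) w) d v)"])
    case root
    define d0 :: "'v set \<Rightarrow> real" where "d0 = (\<lambda>e. if e = e0 then 1 else 0)"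
    show ?case
    proof (cases "r \<in> internal_nodes V E")
      case True
      have inc: "e0 \<in> incident_edges E r" using e0 r by (simp add: incident_edges_def)
      obtain d where d: "d e0 = d0 e0" "\<And>e. e \<notin> incident_edges E r \<Longrightarrow> d e = d0 e"
          "\<And>e. e \<in> incident_edges E r \<Longrightarrow> w $ e = 0 \<or> w $ e = 1 \<Longrightarrow> d e = 0"
          "tangent_at E (($) w) d r"
        using extend_direction_at_node[OF T x True inc, of d0] e0 by blast
      have supp: "e \<in> incident_edges E r" if "d e \<noteq> 0" for e
        using that d(2)[of e] inc by (cases "e = e0") (auto simp: d0_def)
      have "e \<in> E \<and> e \<inter> {r} \<noteq> {} \<and> w $ e \<noteq> 0 \<and> w $ e \<noteq> 1" if "d e \<noteq> 0" for e
        using that supp[OF that] d(3)[OF supp[OF that]] by (auto simp: incident_edges_def)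
      moreover have "d e0 = 1" using d(1) by (simp add: d0_def)
      ultimately show ?thesis using d(4) by (intro exI[of _ d]) simp
    next
      case False
      then show ?thesis using e0 r by (intro exI[of _ d0]) (auto simp: d0_def)
    qed
  next
    case (grow S u v)
    then obtain d where d: "d e0 = 1"
        "\<And>e. d e \<noteq> 0 \<Longrightarrow> e \<in> E \<and> e \<inter> S \<noteq> {} \<and> w $ e \<noteq> 0 \<and> w $ e \<noteq> 1"
        "\<And>y. y \<in> S \<Longrightarrow> y \<in> internal_nodes V E \<Longrightarrow> tangent_at E (($) w) d y"
      by blast
    show ?case
    proof (cases "v \<in> internal_nodes V E")
      case True
      have inc: "{u, v} \<in> incident_edges E v" using grow.hyps(5) by (simp add: incident_edges_def)
      \<comment> \<open>Edges at \<open>v\<close> other than \<open>{u, v}\<close> do not touch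
        \<open>S\<close>, so changing them disturbs no earlier node.\<close>
      have only: "e = {u, v}" if ev: "e \<in> incident_edges E v" and eS: "e \<inter> S \<noteq> {}" for e
      proof -
        obtain y where y: "y \<in> e" "y \<in> S" using eS by blast
        have e: "e \<in> E" "v \<in> e" using ev by (auto simp: incident_edges_def)
        have "y \<noteq> v" using y grow.hyps(4) by blast
        then have "e = {y, v}" using edge(2)[OF e(1)] e y by (auto simp: card_2_iff)
        then show ?thesis using grow.hyps(6)[of y] y e by simp
      qed
      obtain d' where d': "d' {u, v} = d {u, v}" "\<And>e. e \<notin> incident_edges E v \<Longrightarrow> d' e = d e"
          "\<And>e. e \<in> incident_edges E v \<Longrightarrow> w $ e = 0 \<or> w $ e = 1 \<Longrightarrow> d' e = 0"
          "tangent_at E (($) w) d' v"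
        using extend_direction_at_node[OF T x True inc, of d] d(2) by blast
      have same: "d' e = d e" if "e \<inter> S \<noteq> {}" for e
        using only[OF _ that] d'(1,2) by metis
      \<comment> \<open>The invariant says that edges with nonzero change touch \<open>S\<close>;
        hence \<open>e0\<close> does and keeps its value.\<close>
      have "d' e0 = 1" using same d(1) d(2)[of e0] by simp
      moreover have "e \<in> E \<and> e \<inter> insert v S \<noteq> {} \<and> w $ e \<noteq> 0 \<and> w $ e \<noteq> 1" if "d' e \<noteq> 0" for e
      proof (cases "e \<in> incident_edges E v")
        case True
        then show ?thesis using d'(3)[OF True] that by (auto simp: incident_edges_def)
      next
        case False
        then show ?thesis using d'(2)[OF False] d(2)[of e] that by auto
      qed
      moreover have "tangent_at E (($) w) d' y" if "y \<in> S" "y \<in> internal_nodes V E" for y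
      proof -
        have "d e = d' e" if "e \<in> incident_edges E y" for e
        proof -
          have "e \<inter> S \<noteq> {}" using that \<open>y \<in> S\<close> by (auto simp: incident_edges_def)
          then show ?thesis using same by simp
        qed
        then have "tangent_at E (($) w) d y \<longleftrightarrow> tangent_at E (($) w) d' y"
          by (rule tangent_at_cong)
        then show ?thesis using d(3)[OF that] by simp
      qed
      ultimately show ?thesis using d'(4) by (intro exI[of _ d']) blast
    next
      case False
      then show ?thesis using d by (intro exI[of _ d]) blast
    qed
  qed
  then obtain d where d: "?inv V d" by blast
  show ?thesis
  proof (rule that[of d])
    show "tangent_at E (($) w) d v" if "v \<in> internal_nodes V E" for v
      using d that by (auto simp: internal_nodes_def)
  qed (use d in auto)
qed

section \<open>Moving a fractional point both ways\<close>

text \<open>A slack constraint survives small moves by continuity, and a tight one stays tight since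
  \<open>g = 0\<close>. The filter \<open>nhds 0\<close> covers both signs of
  \<open>t\<close>.\<close>

lemma eventually_perturbed_le:
  fixes f g b :: real
  assumes "f \<le> b" "f = b \<Longrightarrow> g = 0"
  shows "\<forall>\<^sub>F t in nhds 0. f + t * g \<le> b"
proof (cases "f = b")
  case False
  have "((\<lambda>t. f + t * g) \<longlongrightarrow> f + 0 * g) (nhds 0)"
    by (intro tendsto_intros) (simp add: filterlim_ident)
  then have "\<forall>\<^sub>F t in nhds 0. f + t * g < b"
    using False assms(1) by (intro order_tendstoD(2)) auto
  then show ?thesis by (rule eventually_mono) simp
qed (use assms in simp)

text \<open>A tangent direction that is nonzero at a fractional edge exhibits the point as the
  midpoint of two different points of the polytope.\<close>

lemma extreme_point_imp_integral:
  fixes V :: "'v::finite set"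
  assumes T: "tree_1_3 V E" and ext: "(w, z) extreme_point_of Q_poly V E"
  shows "w $ e0 = 0 \<or> w $ e0 = 1"
proof (rule ccontr)
  assume frac: "\<not> ?thesis"
  have x: "(w, z) \<in> Q_poly V E" using ext by (simp add: extreme_point_of_def)
  have cs: "(w, z) \<in> coord_space V E" using Q_poly_coord_space[OF x] .
  have "e0 \<in> E" using cs frac by (auto simp: coord_space_def)
  then obtain d where d: "d e0 = 1" "\<And>e. e \<notin> E \<Longrightarrow> d e = 0"
      "\<And>e. w $ e = 0 \<or> w $ e = 1 \<Longrightarrow> d e = 0"
      "\<And>v. v \<in> internal_nodes V E \<Longrightarrow> tangent_at E (($) w) d v"
    using tangent_direction_exists[OF T x] frac by blast
  define D :: "real ^ 'v set" where "D = (\<chi> e. d e)"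
  \<comment> \<open>The node equations force this change of \<open>z\<close> once \<open>w\<close>
    moves along \<open>D\<close>.\<close>
  define Z :: "real ^ 'v" where
    "Z = (\<chi> v. if v \<in> internal_nodes V E then (\<Sum>e\<in>incident_edges E v. d e) / 2 else 0)"
  define P where "P t v a b c \<longleftrightarrow> w $ a + t * d a \<le> w $ b + t * d b + (w $ c + t * d c) \<and>
      w $ a + t * d a + (w $ b + t * d b) + (w $ c + t * d c) = 2 * (z $ v + t * Z $ v) \<and>
      z $ v + t * Z $ v \<le> 1" for t v a b c
  have box: "\<forall>\<^sub>F t in nhds 0. \<forall>e. 0 \<le> w $ e + t * d e \<and> w $ e + t * d e \<le> 1"
  proof (intro eventually_all_finite eventually_conj)
    fix e
    have "0 \<le> w $ e" "w $ e \<le> 1" using Q_poly_bounds(1)[OF T x] by auto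
    then show "\<forall>\<^sub>F t in nhds 0. w $ e + t * d e \<le> 1"
      using d(3)[of e] by (intro eventually_perturbed_le) auto
    have "\<forall>\<^sub>F t in nhds 0. - w $ e + t * - d e \<le> 0"
      using \<open>0 \<le> w $ e\<close> d(3)[of e] by (intro eventually_perturbed_le) auto
    then show "\<forall>\<^sub>F t in nhds 0. 0 \<le> w $ e + t * d e" by (rule eventually_mono) simp
  qed
  have node: "\<forall>\<^sub>F t in nhds 0. P t v a b c"
    if v: "v \<in> internal_nodes V E" and abc: "distinct [a, b, c] \<and> incident_edges E v = {a, b, c}"
    for v a b c
  proof -
    have ineq: "w $ a \<le> w $ b + w $ c" "w $ a + w $ b + w $ c = 2 * z $ v" "z $ v \<le> 1"
      using Q_poly_node_constraints[OF T x v conjunct1[OF abc] conjunct2[OF abc]] by simp_all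
    have tan: "w $ a = w $ b + w $ c \<Longrightarrow> d a = d b + d c"
        "w $ a + w $ b + w $ c = 2 \<Longrightarrow> d a + d b + d c = 0"
      using d(4)[OF v] abc unfolding tangent_at_def by blast+
    have Zv: "2 * Z $ v = d a + d b + d c" using abc v by (auto simp: Z_def)
    have ev1: "\<forall>\<^sub>F t in nhds 0. (w $ a - w $ b - w $ c) + t * (d a - d b - d c) \<le> 0"
      using ineq tan by (intro eventually_perturbed_le) auto
    \<comment> \<open>If \<open>z $ v = 1\<close>, the incident weights sum to 2, and tangency gives
      \<open>Z $ v = 0\<close>.\<close>
    have ev2: "\<forall>\<^sub>F t in nhds 0. z $ v + t * Z $ v \<le> 1"
      using ineq tan Zv by (intro eventually_perturbed_le) auto
    have sum: "w $ a + t * d a + (w $ b + t * d b) + (w $ c + t * d c) = 2 * (z $ v + t * Z $ v)"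
      for t
    proof -
      have "2 * (z $ v + t * Z $ v) = 2 * z $ v + t * (2 * Z $ v)" by (simp add: algebra_simps)
      then show ?thesis using Zv ineq(2) by (simp add: algebra_simps)
    qed
    show ?thesis
      using ev1 ev2
    proof eventually_elim
      case (elim t)
      then show ?case using sum[of t] by (simp add: P_def algebra_simps)
    qed
  qed
  \<comment> \<open>Nodes and edges range over finite types, so one neighbourhood of 0 serves all
    constraints at once.\<close>
  have "\<forall>\<^sub>F t in nhds 0. \<forall>v a b c. v \<in> internal_nodes V E \<longrightarrow>
      distinct [a, b, c] \<and> incident_edges E v = {a, b, c} \<longrightarrow> P t v a b c"
    using node by (intro eventually_all_finite) (auto simp: eventually_mono)
  with box have "\<forall>\<^sub>F t in nhds 0. (w + t *\<^sub>R D, z + t *\<^sub>R Z) \<in> Q_poly V E"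
  proof eventually_elim
    case (elim t)
    have "(w + t *\<^sub>R D, z + t *\<^sub>R Z) \<in> coord_space V E"
      using cs d(2) by (auto simp: coord_space_def D_def Z_def)
    moreover have "\<forall>v\<in>internal_nodes V E. \<forall>a b c.
        distinct [a, b, c] \<and> incident_edges E v = {a, b, c} \<longrightarrow> P t v a b c"
    proof (intro ballI allI impI)
      fix v a b c
      assume "v \<in> internal_nodes V E" "distinct [a, b, c] \<and> incident_edges E v = {a, b, c}"
      then show "P t v a b c" by (rule elim(2)[rule_format])
    qed
    ultimately show ?case
      unfolding mem_Q_poly_iff[OF T] P_def using elim(1)
      by (simp only: D_def vec_lambda_beta vector_add_component vector_scaleR_component
          real_scaleR_def simp_thms)
  qed
  then obtain \<epsilon> where eps: "\<epsilon> > 0" and mem: "\<And>t. dist t 0 < \<epsilon> \<Longrightarrow>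
      (w + t *\<^sub>R D, z + t *\<^sub>R Z) \<in> Q_poly V E"
    unfolding eventually_nhds_metric by blast
  define t where "t = \<epsilon> / 2"
  let ?p = "(w + t *\<^sub>R D, z + t *\<^sub>R Z)" and ?q = "(w + (- t) *\<^sub>R D, z + (- t) *\<^sub>R Z)"
  have t: "t > 0" "?p \<in> Q_poly V E" "?q \<in> Q_poly V E"
    using eps mem[of t] mem[of "- t"] by (auto simp: t_def)
  have "(w + t *\<^sub>R D) $ e0 \<noteq> (w + (- t) *\<^sub>R D) $ e0" using t(1) d(1) by (simp add: D_def)
  then have "?p \<noteq> ?q" by (metis prod.inject)
  moreover have "(w, z) = midpoint ?p ?q"
    by (simp add: midpoint_def scaleR_2[symmetric] algebra_simps)
  ultimately have "(w, z) \<in> open_segment ?p ?q" using midpoint_in_open_segment by metis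
  then show False using ext t unfolding extreme_point_of_def by blast
qed

theorem theorem4:
  fixes V :: "'v::finite set" and E :: "'v set set"
  assumes "tree_1_3 V E"
  shows "{x. x extreme_point_of Q_poly V E} = {char_vec V E H | H. disjoint_leaf_paths V E H}"
proof (intro set_eqI iffI)
  fix x assume "x \<in> {x. x extreme_point_of Q_poly V E}"
  moreover obtain w z where "x = (w, z)" by fastforce
  ultimately have ext: "(w, z) extreme_point_of Q_poly V E" and x: "x = (w, z)" by auto
  have "(w, z) \<in> Q_poly V E" using ext by (simp add: extreme_point_of_def)
  then obtain H where "disjoint_leaf_paths V E H" "char_vec V E H = (w, z)"
    using integral_imp_char_vec[OF assms _ extreme_point_imp_integral[OF assms ext]] by blast
  then show "x \<in> {char_vec V E H | H. disjoint_leaf_paths V E H}" using x by force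
next
  fix x assume "x \<in> {char_vec V E H | H. disjoint_leaf_paths V E H}"
  then obtain H where H: "x = char_vec V E H" "disjoint_leaf_paths V E H" by blast
  obtain w z where wz: "char_vec V E H = (w, z)" by fastforce
  have "w $ e = 0 \<or> w $ e = 1" for e
    using arg_cong[OF wz, of "\<lambda>x. fst x $ e"] by (simp add: char_vec_def split: if_splits)
  then have "(w, z) extreme_point_of Q_poly V E"
    using integral_imp_extreme_point[OF assms] char_vec_in_Q_poly[OF assms H(2)] wz by simp
  then show "x \<in> {x. x extreme_point_of Q_poly V E}" using H(1) wz by simp
qed

end
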